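(* Let $n\ge 1$ be an integer, let $\theta$ be a real number, and let $\mathbf{z}=\{z_1,\dots,z_n\}$ be a multiset of $n$ complex numbers, all lying on the unit circle $\mathcal{U}=\{z\in\mathbb{C} : |z|=1\}$. Let $P(z)=\prod_{i=1}^n (z-z_i)$ and $$C_\theta(P)=\{z\in\mathbb{C} : \operatorname{Im}(e^{-i\theta}P(z))=0\}.$$ Set $$\Omega:=\frac{2\theta-\sum_{j=1}^n \operatorname{Arg}(z_j)}{n}-\pi ,$$ and let $$G(\mathbf{z})=\Big\{e^{i(\Omega+2k\pi/n)} : k=1,\dots,n\Big\}$$ be the set of vertices of the corresponding regular $n$-gon on $\mathcal{U}$. Then $$C_\theta(P)\cap\mathcal{U}=\mathbf{z}\cup G(\mathbf{z}).$$
   Context: For a nonzero complex number $z$, $\operatorname{Arg}(z)$ denotes any chosen real determination of the argument of $z$ (which is well defined modulo $2\pi$); changing the determination of some $\operatorname{Arg}(z_j)$ changes $\Omega$ by a multiple of $2\pi/n$ and so does not change the set $G(\mathbf{z})$. The points $z_1,\dots,z_n$ need not be distinct; in the equality $C_\theta(P)\cap\mathcal{U}=\mathbf{z}\cup G(\mathbf{z})$, which is an equality of subsets of $\mathbb{C}$, $\mathbf{z}$ stands for its underlying set of points. *)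

theory Defs
  imports "HOL-Analysis.Analysis" "HOL-Computational_Algebra.Polynomial"
begin

abbreviation unit_circle :: "complex set" where
  "unit_circle \<equiv> sphere 0 1"

text \<open>A multiset \<open>{z\<^sub>1, \<dots>, z\<^sub>n}\<close> is given by an indexed family \<open>z\<close>, of which only the
  values at \<open>1, \<dots>, n\<close> are used; repetitions are allowed.\<close>

definition root_poly :: "nat \<Rightarrow> (nat \<Rightarrow> complex) \<Rightarrow> complex poly" where
  "root_poly n z = (\<Prod>i=1..n. [:- z i, 1:])"

definition C_curve :: "real \<Rightarrow> complex poly \<Rightarrow> complex set" where
  "C_curve \<theta> P = {w. Im (exp (- (\<i> * complex_of_real \<theta>)) * poly P w) = 0}"

text \<open>In \<open>Omega\<close>, \<open>a j\<close> is the chosen determination of the argument of \<open>z j\<close>.\<close>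

definition Omega :: "nat \<Rightarrow> real \<Rightarrow> (nat \<Rightarrow> real) \<Rightarrow> real" where
  "Omega n \<theta> a = (2 * \<theta> - (\<Sum>j=1..n. a j)) / real n - pi"

definition ngon :: "nat \<Rightarrow> real \<Rightarrow> complex set" where
  "ngon n \<omega> = {exp (\<i> * complex_of_real (\<omega> + 2 * real k * pi / real n)) | k. k \<in> {1..n}}"

end

theory Submission
  imports Defs
begin

text \<open>
  A chord of the unit circle has a known direction: \<open>cis t - cis a\<close> is a real multiple of
  \<open>cis ((t + a + pi) / 2)\<close>, the real factor \<open>2 * sin ((t - a) / 2)\<close> vanishing exactly when the
  two points coincide (\<open>cis_diff\<close>). Multiplying these identities over all roots writes
  \<open>exp (- \<i> * \<theta>) * P (cis t)\<close> as a real number times \<open>cis \<phi>\<close>, where \<open>\<phi>\<close> is an affine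
  function of \<open>t\<close> with slope \<open>n / 2\<close>. Hence its imaginary part vanishes iff the real factor
  does, which means that \<open>cis t\<close> is one of the roots, or \<open>sin \<phi> = 0\<close>. Since
  \<open>\<phi> = n * (t - Omega) / 2\<close>, the second condition says that \<open>cis t\<close> and \<open>cis Omega\<close> have the
  same \<open>n\<close>-th power, and the solutions of this equation form the regular \<open>n\<close>-gon (\<open>ngon_eq\<close>).
\<close>

text \<open>Half-angle form of a chord: factoring \<open>cis ((t + a) / 2)\<close> out of the difference leaves
  \<open>cis ((t - a) / 2) - cis (- (t - a) / 2)\<close>, which is \<open>2 * \<i> * sin ((t - a) / 2)\<close>; the
  factor \<open>\<i>\<close> is absorbed as a rotation by \<open>pi / 2\<close>.\<close>

lemma cis_diff:
  "cis t - cis a = complex_of_real (2 * sin ((t - a) / 2)) * cis ((t + a + pi) / 2)"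
proof -
  define u v where "u = (t - a) / 2" and "v = (t + a) / 2"
  have t: "t = v + u" and a: "a = v - u"
    unfolding u_def v_def by (simp_all add: field_simps)
  have "(t + a + pi) / 2 = v + pi / 2"
    unfolding v_def by (simp add: field_simps)
  moreover have "cis (v + u) - cis (v - u) = complex_of_real (2 * sin u) * cis (v + pi / 2)"
    by (simp add: complex_eq_iff cos_add cos_diff sin_add sin_diff)
  ultimately show ?thesis
    by (simp only: u_def[symmetric] t[symmetric] a[symmetric])
qed

lemma cis_sum: "finite A \<Longrightarrow> (\<Prod>i\<in>A. cis (f i)) = cis (\<Sum>i\<in>A. f i)"
  by (induction A rule: finite_induct) (simp_all add: cis_mult)

lemma sin_eq_0_iff_cis_double: "sin x = 0 \<longleftrightarrow> cis (2 * x) = 1"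
  by (auto simp: complex_eq_iff cos_double_sin sin_double)

text \<open>The vertices of the \<open>n\<close>-gon are the \<open>n\<close>-th roots of unity rotated by \<open>\<omega>\<close>. Roots of unity
  are usually indexed from \<open>0\<close>, the vertices from \<open>1\<close>; the indices \<open>0\<close> and \<open>n\<close> give the same
  point.\<close>

lemma ngon_eq:
  assumes "n \<ge> 1"
  shows "ngon n \<omega> = {w. w ^ n = cis (real n * \<omega>)}"
proof -
  have roots: "(\<lambda>k. cis (2 * pi * real k / real n)) ` {..<n} = {w. w ^ n = 1}"
    using Complex.bij_betw_roots_unity[of n] assms by (simp add: bij_betw_def)
  have vertex: "exp (\<i> * complex_of_real (\<omega> + 2 * real k * pi / real n))
      = cis \<omega> * cis (2 * pi * real k / real n)" for k
    by (simp add: cis_conv_exp exp_add[symmetric] algebra_simps)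
  show ?thesis
  proof (intro set_eqI iffI)
    fix w assume "w \<in> ngon n \<omega>"
    then obtain k where "w = cis \<omega> * cis (2 * pi * real k / real n)"
      unfolding ngon_def vertex by blast
    then show "w \<in> {w. w ^ n = cis (real n * \<omega>)}"
      using assms cis_multiple_2pi[of "real k"]
      by (simp add: power_mult_distrib Complex.DeMoivre)
  next
    fix w assume "w \<in> {w. w ^ n = cis (real n * \<omega>)}"
    then have "(w * cis (- \<omega>)) ^ n = 1"
      by (simp add: power_mult_distrib Complex.DeMoivre cis_mult)
    then have "w * cis (- \<omega>) \<in> (\<lambda>k. cis (2 * pi * real k / real n)) ` {..<n}"
      using roots by simp
    then obtain k where k: "k < n" "w * cis (- \<omega>) = cis (2 * pi * real k / real n)"
      by auto
    define k' where "k' = (if k = 0 then n else k)"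
    have "k' \<in> {1..n}"
      using k(1) assms by (auto simp: k'_def)
    moreover have "cis (2 * pi * real k' / real n) = cis (2 * pi * real k / real n)"
      using assms by (simp add: k'_def)
    moreover have "w = cis \<omega> * cis (2 * pi * real k / real n)"
      unfolding k(2)[symmetric] mult.left_commute[of "cis \<omega>" w] by (simp add: cis_mult)
    ultimately show "w \<in> ngon n \<omega>"
      unfolding ngon_def vertex by (auto intro!: exI[of _ k'])
  qed
qed

text \<open>The sum over \<open>j\<close> of the directions \<open>(t + a j + pi) / 2\<close>, lowered by \<open>\<theta>\<close>, is
  \<open>n * (t - Omega) / 2\<close>; this is where the value of \<open>Omega\<close> comes from.\<close>

lemma exp_root_poly_cis:
  assumes "n \<ge> 1" and "\<And>j. j \<in> {1..n} \<Longrightarrow> z j = cis (a j)"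
  shows "exp (- (\<i> * complex_of_real \<theta>)) * poly (root_poly n z) (cis t)
    = complex_of_real (\<Prod>j=1..n. 2 * sin ((t - a j) / 2))
      * cis (real n * (t - Omega n \<theta> a) / 2)"
proof -
  have "poly (root_poly n z) (cis t) = (\<Prod>j=1..n. cis t - cis (a j))"
    unfolding root_poly_def poly_prod using assms(2) by (intro prod.cong) auto
  also have "\<dots> = complex_of_real (\<Prod>j=1..n. 2 * sin ((t - a j) / 2))
      * cis (\<Sum>j=1..n. (t + a j + pi) / 2)"
    by (simp only: cis_diff prod.distrib cis_sum finite_atLeastAtMost of_real_prod of_real_mult)
  finally have "exp (- (\<i> * complex_of_real \<theta>)) * poly (root_poly n z) (cis t)
      = complex_of_real (\<Prod>j=1..n. 2 * sin ((t - a j) / 2))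
        * (cis (- \<theta>) * cis (\<Sum>j=1..n. (t + a j + pi) / 2))"
    by (simp add: cis_conv_exp)
  moreover have "- \<theta> + (\<Sum>j=1..n. (t + a j + pi) / 2) = real n * (t - Omega n \<theta> a) / 2"
    using assms(1)
    by (simp add: Omega_def sum_divide_distrib[symmetric] sum.distrib field_simps)
  ultimately show ?thesis
    by (simp only: cis_mult)
qed

theorem proposition1:
  fixes n :: nat and \<theta> :: real and z :: "nat \<Rightarrow> complex" and a :: "nat \<Rightarrow> real"
  assumes "n \<ge> 1"
    and "\<And>j. j \<in> {1..n} \<Longrightarrow> z j \<in> unit_circle"
    and "\<And>j. j \<in> {1..n} \<Longrightarrow> is_Arg (z j) (a j)"
  shows "C_curve \<theta> (root_poly n z) \<inter> unit_circle = z ` {1..n} \<union> ngon n (Omega n \<theta> a)"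
proof -
  let ?\<Omega> = "Omega n \<theta> a"
  have z: "z j = cis (a j)" if "j \<in> {1..n}" for j
    using assms(2,3)[OF that] by (simp add: is_Arg_def cis_conv_exp)
  have on_circle: "cis t \<in> C_curve \<theta> (root_poly n z) \<longleftrightarrow> cis t \<in> z ` {1..n} \<union> ngon n ?\<Omega>" for t
  proof -
    have "cis t \<in> C_curve \<theta> (root_poly n z) \<longleftrightarrow>
        (\<Prod>j=1..n. 2 * sin ((t - a j) / 2)) = 0 \<or> sin (real n * (t - ?\<Omega>) / 2) = 0"
      unfolding C_curve_def mem_Collect_eq
      by (subst exp_root_poly_cis[OF assms(1) z]) (simp_all del: of_real_prod)
    also have "(\<Prod>j=1..n. 2 * sin ((t - a j) / 2)) = 0 \<longleftrightarrow> (\<exists>j\<in>{1..n}. cis t - cis (a j) = 0)"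
      unfolding cis_diff by simp
    also have "\<dots> \<longleftrightarrow> cis t \<in> z ` {1..n}"
      using z by auto
    also have "sin (real n * (t - ?\<Omega>) / 2) = 0 \<longleftrightarrow> cis (real n * t) / cis (real n * ?\<Omega>) = 1"
      unfolding sin_eq_0_iff_cis_double by (simp add: cis_divide flip: right_diff_distrib)
    also have "\<dots> \<longleftrightarrow> cis t \<in> ngon n ?\<Omega>"
      by (simp add: ngon_eq[OF assms(1)] Complex.DeMoivre)
    finally show ?thesis
      by simp
  qed
  have subset: "z ` {1..n} \<union> ngon n ?\<Omega> \<subseteq> unit_circle"
    using assms(2) by (auto simp: ngon_def simp del: of_real_add)
  have same: "w \<in> C_curve \<theta> (root_poly n z) \<longleftrightarrow> w \<in> z ` {1..n} \<union> ngon n ?\<Omega>"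
    if "w \<in> unit_circle" for w
  proof -
    have "cis (Arg2pi w) = w"
      using that by (simp add: complex_norm_eq_1_exp cis_conv_exp)
    then show ?thesis
      using on_circle[of "Arg2pi w"] by (simp only:)
  qed
  show ?thesis
  proof (intro set_eqI iffI)
    fix w assume "w \<in> C_curve \<theta> (root_poly n z) \<inter> unit_circle"
    then show "w \<in> z ` {1..n} \<union> ngon n ?\<Omega>"
      using same[of w] by (simp only: Int_iff)
  next
    fix w assume w: "w \<in> z ` {1..n} \<union> ngon n ?\<Omega>"
    then have "w \<in> unit_circle"
      by (rule subsetD[OF subset])
    then show "w \<in> C_curve \<theta> (root_poly n z) \<inter> unit_circle"
      using same[of w] w by (simp only: Int_iff)
  qed
qed

end
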